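(* Let $n,m$ be positive integers and let $a,b$ be integers with $1\le a<n$ and $1\le b<m$. The additive subgroup generated by $(a,b)$ in the ring $\mathbb{Z}_n\times\mathbb{Z}_m$ is an ideal if and only if \[ \gcd\left(\frac{n}{\gcd(a,n)}, \frac{m}{\gcd(b,m)}\right)=1.\]
   Context: $\mathbb{Z}_N$ is the ring of integers modulo $N$; product rings have componentwise operations. Integers $a,b$ are identified with their residue classes in $\mathbb{Z}_n$ and $\mathbb{Z}_m$. *)

theory Defs
  imports
    "HOL-Number_Theory.Residues"
    "HOL-Algebra.Chinese_Remainder"
    "HOL-Algebra.Generated_Groups"
begin

end

theory Submission
  imports Defs "HOL-Algebra.Elementary_Groups"
begin

text \<open>
  The subgroup \<open>I\<close> generated by \<open>(a, b)\<close> consists of the pairs \<open>(k a, k b)\<close> with \<open>k\<close> an integer.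
  The additive orders of \<open>a\<close> and \<open>b\<close> are \<open>p = n / gcd(a, n)\<close> and \<open>q = m / gcd(b, m)\<close>, so
  \<open>k a = l a\<close> in \<open>\<int>\<^sub>n\<close> means \<open>k \<equiv> l\<close> modulo \<open>p\<close>, and likewise for \<open>b\<close> and \<open>q\<close>.

  Multiplying \<open>(k a, k b)\<close> by \<open>(s, t)\<close> gives \<open>(s k a, t k b)\<close>. This lies in \<open>I\<close> if and only if some
  integer \<open>l\<close> satisfies \<open>l \<equiv> s k\<close> modulo \<open>p\<close> and \<open>l \<equiv> t k\<close> modulo \<open>q\<close>. If \<open>p\<close> and \<open>q\<close> are coprime,
  the Chinese remainder theorem supplies such an \<open>l\<close>. Conversely, if \<open>I\<close> is an ideal, then it
  contains \<open>(1, 0) (a, b) = (a, 0)\<close>, and the resulting \<open>l\<close>, congruent to 1 modulo \<open>p\<close> and to 0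
  modulo \<open>q\<close>, forces \<open>gcd(p, q)\<close> to divide 1.
\<close>

text \<open>
  Cancelling \<open>gcd a n\<close> from \<open>n\<close> and \<open>a\<close> leaves coprime numbers, so \<open>n\<close> divides \<open>(k - l) a\<close> exactly
  when \<open>n div gcd a n\<close> divides \<open>k - l\<close>.
\<close>

lemma cong_mult_rcancel_div_gcd:
  fixes n a k l :: int
  assumes "n \<noteq> 0"
  shows "[k * a = l * a] (mod n) \<longleftrightarrow> [k = l] (mod (n div gcd a n))"
proof -
  define g where "g = gcd a n"
  have "g \<noteq> 0" using assms by (simp add: g_def)
  have n: "n = g * (n div g)" and a: "a = g * (a div g)"
    by (simp_all add: g_def)
  have cop: "coprime (n div g) (a div g)"
    using assms by (metis div_gcd_coprime coprime_commute g_def)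
  have "n dvd (k - l) * a \<longleftrightarrow> g * (n div g) dvd g * ((k - l) * (a div g))"
    using n a by (metis mult.left_commute)
  also have "\<dots> \<longleftrightarrow> n div g dvd (k - l) * (a div g)"
    using \<open>g \<noteq> 0\<close> by simp
  also have "\<dots> \<longleftrightarrow> n div g dvd k - l"
    using cop by (simp add: coprime_dvd_mult_left_iff)
  finally show ?thesis
    by (simp add: cong_iff_dvd_diff left_diff_distrib g_def)
qed

lemma generate_integer_group_1: "generate integer_group {1} = UNIV"
  using group.generate_pow[OF group_integer_group, of 1] by simp

lemma ring_RDirProd_residue_ring:
  assumes "n > 1" and "m > 1"
  shows "ring (RDirProd (residue_ring n) (residue_ring m))"
  using assms by (intro RDirProd_ring cring.axioms(1) residues.cring residues.intro) auto

text \<open>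
  The subgroup is the image of the additive group of integers under the homomorphism that sends
  1 to \<open>(a, b)\<close>.
\<close>

lemma generate_RDirProd_residue_ring:
  fixes n m a b :: int
  assumes "n > 1" and "m > 1" and "a \<in> {0..<n}" and "b \<in> {0..<m}"
  shows "generate (add_monoid (RDirProd (residue_ring n) (residue_ring m))) {(a, b)}
           = range (\<lambda>k. (k * a mod n, k * b mod m))"
proof -
  define R where "R = RDirProd (residue_ring n) (residue_ring m)"
  define f where "f = (\<lambda>k. (k * a mod n, k * b mod m))"
  have "ring R"
    using assms ring_RDirProd_residue_ring by (simp add: R_def)
  then have "group (add_monoid R)"
    by (intro abelian_group.a_group ring.is_abelian_group)
  moreover have "f \<in> hom integer_group (add_monoid R)"
    using assms
    by (auto simp: hom_def f_def R_def RDirProd_def DirProd_def monoid.defs residue_ring_def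
        mod_add_eq distrib_right)
  ultimately have "group_hom integer_group (add_monoid R) f"
    by (simp add: group_hom_def group_hom_axioms_def)
  from group_hom.generate_img[OF this, of "{1}"]
  have "generate (add_monoid R) (f ` {1}) = range f"
    by (simp add: generate_integer_group_1)
  then show ?thesis
    using assms by (simp add: f_def R_def)
qed

theorem theorem4p1:
  fixes n m a b :: int
  assumes "n > 0" and "m > 0"
    and "1 \<le> a" and "a < n"
    and "1 \<le> b" and "b < m"
  shows "ideal (generate (add_monoid (RDirProd (residue_ring n) (residue_ring m))) {(a, b)})
           (RDirProd (residue_ring n) (residue_ring m))
         \<longleftrightarrow> gcd (n div gcd a n) (m div gcd b m) = 1"
proof -
  define R where "R = RDirProd (residue_ring n) (residue_ring m)"
  define I where "I = generate (add_monoid R) {(a, b)}"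
  define p where "p = n div gcd a n"
  define q where "q = m div gcd b m"
  have "n > 1" and "m > 1" using assms by auto
  have I: "I = range (\<lambda>k. (k * a mod n, k * b mod m))"
    unfolding I_def R_def using assms by (intro generate_RDirProd_residue_ring) auto
  have carrier: "carrier R = {0..<n} \<times> {0..<m}"
    by (auto simp: R_def RDirProd_carrier residue_ring_def)
  have mult: "(s, t) \<otimes>\<^bsub>R\<^esub> (x, y) = (s * x mod n, t * y mod m)" for s t x y
    by (simp add: R_def RDirProd_def DirProd_def monoid.defs residue_ring_def)
  have mem_I: "(k * a mod n, l * b mod m) \<in> I \<longleftrightarrow> (\<exists>j. [j = k] (mod p) \<and> [j = l] (mod q))"
    for k l
  proof -
    have "(k * a mod n, l * b mod m) \<in> I
            \<longleftrightarrow> (\<exists>j. [j * a = k * a] (mod n) \<and> [j * b = l * b] (mod m))"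
      unfolding I cong_def by (auto simp: image_iff intro: sym)
    then show ?thesis
      using assms by (simp add: cong_mult_rcancel_div_gcd p_def q_def)
  qed
  have "ideal I R \<longleftrightarrow> coprime p q"
  proof
    assume "ideal I R"
    moreover have "(a, b) \<in> I"
      unfolding I_def by (simp add: generate.incl)
    moreover have "(1, 0) \<in> carrier R"
      using \<open>n > 1\<close> \<open>m > 1\<close> by (simp add: carrier)
    ultimately have "(1, 0) \<otimes>\<^bsub>R\<^esub> (a, b) \<in> I"
      by (rule ideal.I_l_closed)
    then obtain j where j: "[j = 1] (mod p)" "[j = 0] (mod q)"
      using mem_I[of 1 0] by (auto simp: mult)
    have "coprime j p"
      using cong_imp_coprime[OF cong_sym[OF j(1)]] by simp
    moreover have "q dvd j"
      using j(2) by (simp add: cong_0_iff)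
    ultimately show "coprime p q"
      by (meson coprime_commute coprime_divisors dvd_refl)
  next
    assume "coprime p q"
    have "ring R"
      unfolding R_def using \<open>n > 1\<close> \<open>m > 1\<close> by (rule ring_RDirProd_residue_ring)
    then have "group (add_monoid R)"
      by (intro abelian_group.a_group ring.is_abelian_group)
    then have subgroup: "subgroup I (add_monoid R)"
      unfolding I_def using assms by (intro group.generate_is_subgroup) (auto simp: carrier)
    have l_closed: "y \<otimes>\<^bsub>R\<^esub> x \<in> I" if "x \<in> I" for x y
    proof -
      obtain k where x: "x = (k * a mod n, k * b mod m)"
        using \<open>x \<in> I\<close> unfolding I by auto
      obtain s t where y: "y = (s, t)" by (cases y)
      have "\<exists>j. [j = s * k] (mod p) \<and> [j = t * k] (mod q)"
        using \<open>coprime p q\<close> by (rule binary_chinese_remainder_int)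
      then have "((s * k) * a mod n, (t * k) * b mod m) \<in> I"
        by (simp only: mem_I)
      then show ?thesis
        by (simp add: x y mult mod_mult_right_eq mult.assoc)
    qed
    have comm: "x \<otimes>\<^bsub>R\<^esub> y = y \<otimes>\<^bsub>R\<^esub> x" for x y
      by (cases x; cases y) (simp add: mult mult.commute)
    show "ideal I R"
      using \<open>ring R\<close> subgroup l_closed by (intro idealI) (simp_all add: comm)
  qed
  then show ?thesis
    by (simp only: I_def R_def p_def q_def coprime_iff_gcd_eq_1)
qed

end
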